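(* Let $\mathcal{U}:\mathbb{R}^d\to\mathbb{R}$ be the potential $\mathcal{U}(\theta) = \mathcal{L}_{\mathrm{pred}}(\theta)+\gamma\Omega(\theta)+\lambda\mathcal{R}_{\mathrm{dec}}(\theta)$, and let $\rho_t$ be probability densities on $\mathbb{R}^d$, smooth and decaying sufficiently fast at infinity, evolving according to $$\partial_t\rho_t = \nabla_\theta\cdot(\rho_t\nabla_\theta\mathcal{U}) + \beta\Delta\rho_t.$$ Let $$\mathcal{S}(\rho_t) = -\int\rho_t(\theta)\log\rho_t(\theta)\,d\theta$$ be the Shannon entropy of the parameter distribution. Then $$\frac{d}{dt}\mathcal{S}(\rho_t) = -\int\rho_t(\theta)\,\Delta\mathcal{U}(\theta)\,d\theta + \beta\int\rho_t(\theta)\,\|\nabla\log\rho_t(\theta)\|^2\,d\theta.$$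
   Context: $\mathcal{L}_{\mathrm{pred}}$, $\Omega$, $\mathcal{R}_{\mathrm{dec}}$ are real-valued functions of the parameter $\theta\in\mathbb{R}^d$ (predictive loss, structural penalty, decision-aware risk), regular enough that $\Delta\mathcal{U}$ is defined; $\gamma,\lambda$ are constant coefficients and $\beta\ge 0$ is the constant entropy coefficient (the evolution is the Fokker-Planck equation of $d\theta_t = -\nabla\mathcal{U}(\theta_t)\,dt+\sqrt{2\beta}\,dW_t$). "Decaying sufficiently fast at infinity" means fast enough that the integrals are finite, differentiation under the integral is allowed, and boundary terms in integrations by parts vanish. *)

theory Defs
  imports "HOL-Analysis.Analysis"
begin

(* Intended for open S, where C_k_on k f S says that f is k times continuously differentiable. *)
primrec C_k_on :: "nat \<Rightarrow> ('a::real_normed_vector \<Rightarrow> 'b::real_normed_vector) \<Rightarrow> 'a set \<Rightarrow> bool" where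
  "C_k_on 0 f S \<longleftrightarrow> continuous_on S f"
| "C_k_on (Suc k) f S \<longleftrightarrow>
     (\<forall>x\<in>S. f differentiable (at x)) \<and>
     (\<forall>v. C_k_on k (\<lambda>x. frechet_derivative f (at x) v) S)"

definition smooth_on :: "('a::real_normed_vector \<Rightarrow> 'b::real_normed_vector) \<Rightarrow> 'a set \<Rightarrow> bool" where
  "smooth_on f S \<longleftrightarrow> (\<forall>k. C_k_on k f S)"

definition gradient :: "('a::euclidean_space \<Rightarrow> real) \<Rightarrow> 'a \<Rightarrow> 'a" where
  "gradient f x = (\<Sum>b\<in>Basis. frechet_derivative f (at x) b *\<^sub>R b)"

definition divergence :: "('a::euclidean_space \<Rightarrow> 'a) \<Rightarrow> 'a \<Rightarrow> real" where
  "divergence F x = (\<Sum>b\<in>Basis. frechet_derivative F (at x) b \<bullet> b)"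

definition laplacian :: "('a::euclidean_space \<Rightarrow> real) \<Rightarrow> 'a \<Rightarrow> real" where
  "laplacian f = divergence (gradient f)"

definition potential ::
    "('a \<Rightarrow> real) \<Rightarrow> ('a \<Rightarrow> real) \<Rightarrow> ('a \<Rightarrow> real) \<Rightarrow> real \<Rightarrow> real \<Rightarrow> 'a \<Rightarrow> real" where
  "potential L_pred Omega R_dec \<gamma> lam \<theta> = L_pred \<theta> + \<gamma> * Omega \<theta> + lam * R_dec \<theta>"

(* Library convention ln 0 = 0; in any case 0 * ln 0 = 0, the usual convention for entropy. *)
definition shannon_entropy :: "('a::euclidean_space \<Rightarrow> real) \<Rightarrow> real" where
  "shannon_entropy p = - (LINT \<theta>|lborel. p \<theta> * ln (p \<theta>))"

definition prob_density :: "('a::euclidean_space \<Rightarrow> real) \<Rightarrow> bool" where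
  "prob_density p \<longleftrightarrow> (\<forall>\<theta>. 0 \<le> p \<theta>) \<and> has_bochner_integral lborel p 1"

definition fokker_planck_on ::
    "real set \<Rightarrow> ('a::euclidean_space \<Rightarrow> real) \<Rightarrow> real \<Rightarrow> (real \<Rightarrow> 'a \<Rightarrow> real) \<Rightarrow> bool" where
  "fokker_planck_on T U \<beta> \<rho> \<longleftrightarrow>
     (\<forall>t\<in>T. \<forall>\<theta>. ((\<lambda>s. \<rho> s \<theta>) has_real_derivative
        divergence (\<lambda>x. \<rho> t x *\<^sub>R gradient U x) \<theta> + \<beta> * laplacian (\<rho> t) \<theta>) (at t))"

(* The outward flux of F through the boundary of the cube [-R, R]^d: for each coordinate
   direction b, the point y of the (d-1)-dimensional cube parametrizes the two faces
   on which the b-coordinate is R and -R. *)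
definition cube_flux :: "('a::euclidean_space \<Rightarrow> 'a) \<Rightarrow> real \<Rightarrow> real" where
  "cube_flux F R =
     (\<Sum>b\<in>Basis. LINT y:(\<Pi>\<^sub>E j\<in>Basis - {b}. {- R..R})|(\<Pi>\<^sub>M j\<in>Basis - {b}. lborel).
        F ((\<Sum>j\<in>Basis - {b}. y j *\<^sub>R j) + R *\<^sub>R b) \<bullet> b
      - F ((\<Sum>j\<in>Basis - {b}. y j *\<^sub>R j) - R *\<^sub>R b) \<bullet> b)"

definition no_boundary_term :: "('a::euclidean_space \<Rightarrow> 'a) \<Rightarrow> bool" where
  "no_boundary_term F \<longleftrightarrow> (cube_flux F \<longlongrightarrow> 0) at_top"

(* "Decaying sufficiently fast at infinity", at every time t in T:
   (1) the entropy integrand and the integrands in the entropy balance are integrable;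
   (2) the time derivative of the entropy integrand is dominated, locally uniformly in time;
   (3) no boundary terms arise when integrating by parts. With the probability flux
       J = rho grad U + beta grad rho, so that d/dt rho = div J, the fields concerned are J
       (conservation of mass), (ln rho) J (for - int (ln rho) div J) and rho grad U
       (for int grad rho . grad U). *)
definition sufficient_decay ::
    "real set \<Rightarrow> ('a::euclidean_space \<Rightarrow> real) \<Rightarrow> real \<Rightarrow> (real \<Rightarrow> 'a \<Rightarrow> real) \<Rightarrow> bool" where
  "sufficient_decay T U \<beta> \<rho> \<longleftrightarrow> (\<forall>t\<in>T.
     integrable lborel (\<lambda>\<theta>. \<rho> t \<theta> * ln (\<rho> t \<theta>)) \<and>
     integrable lborel (\<lambda>\<theta>. \<rho> t \<theta> * laplacian U \<theta>) \<and>
     integrable lborel (\<lambda>\<theta>. \<beta> * (\<rho> t \<theta> * (norm (gradient (\<lambda>x. ln (\<rho> t x)) \<theta>))\<^sup>2)) \<and>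
     (\<exists>\<epsilon>>0. \<exists>g. integrable lborel g \<and>
        (\<forall>s\<in>T. dist s t < \<epsilon> \<longrightarrow>
           (\<forall>\<theta>. \<bar>deriv (\<lambda>r. \<rho> r \<theta> * ln (\<rho> r \<theta>)) s\<bar> \<le> g \<theta>))) \<and>
     (let J = (\<lambda>\<theta>. \<rho> t \<theta> *\<^sub>R gradient U \<theta> + \<beta> *\<^sub>R gradient (\<rho> t) \<theta>) in
        no_boundary_term J \<and>
        no_boundary_term (\<lambda>\<theta>. ln (\<rho> t \<theta>) *\<^sub>R J \<theta>) \<and>
        no_boundary_term (\<lambda>\<theta>. \<rho> t \<theta> *\<^sub>R gradient U \<theta>)))"

end

theory Submission
  imports Defs
begin

text \<open>
  With the flux \<open>J = \<rho> \<nabla>U + \<beta> \<nabla>\<rho>\<close> the evolution reads \<open>\<partial>\<^sub>t \<rho> = div J\<close>, so differentiating under the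
  integral gives \<open>dS/dt = - \<integral> (ln \<rho> + 1) div J\<close>. Integrating by parts on growing cubes
  turns this into \<open>\<integral> \<nabla>(ln \<rho>) \<bullet> J = \<integral> \<nabla>\<rho> \<bullet> \<nabla>U + \<beta> \<integral> \<rho> |\<nabla>(ln \<rho>)|^2\<close>, and a second integration
  by parts turns the first summand into \<open>- \<integral> \<rho> \<Delta>U\<close>.

  The density may vanish, where \<open>ln \<rho>\<close> is singular. What saves the argument is that a
  nonnegative \<open>C\<^sup>2\<close> function satisfies \<open>|Df| \<le> C sqrt f\<close> on compact sets: applied in space and in
  time this bounds \<open>\<nabla>\<rho>\<close>, \<open>J\<close> and \<open>div J = \<partial>\<^sub>t \<rho>\<close> by a multiple of \<open>sqrt \<rho>\<close>, which absorbs the logarithm.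
\<close>

section \<open>Continuously differentiable functions and vector calculus\<close>

text \<open>\<open>C_k_on\<close> speaks of the chosen operator \<open>frechet_derivative\<close>.
  Uniqueness of derivatives lets an explicit candidate \<open>F'\<close> stand in for it, and this
  yields the closure rules below.\<close>

lemma C_k_on_1_UNIV_I:
  assumes "\<And>x. (F has_derivative F' x) (at x)"
    and "\<And>v. continuous_on UNIV (\<lambda>x. F' x v)"
  shows "C_k_on 1 F UNIV"
proof -
  have "frechet_derivative F (at x) = F' x" for x
    using frechet_derivative_at[OF assms(1)] by simp
  with assms show ?thesis by (auto simp: differentiable_def)
qed

lemma C_k_on_has_derivative:
  assumes "C_k_on (Suc k) F S" "x \<in> S"
  shows "(F has_derivative frechet_derivative F (at x)) (at x)"
  using assms by (auto simp: frechet_derivative_works)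

lemma C_k_on_continuous_on:
  assumes "C_k_on k F S"
  shows "continuous_on S F"
proof (cases k)
  case (Suc m)
  with assms have "F differentiable (at x)" if "x \<in> S" for x using that by auto
  then show ?thesis
    by (meson continuous_at_imp_continuous_on differentiable_imp_continuous_within)
qed (use assms in simp)

lemma C_k_on_1_add:
  assumes "C_k_on 1 F UNIV" "C_k_on 1 G UNIV"
  shows "C_k_on 1 (\<lambda>x. F x + G x) UNIV"
  using assms
  by (intro C_k_on_1_UNIV_I[where F' = "\<lambda>x v. frechet_derivative F (at x) v + frechet_derivative G (at x) v"])
     (auto intro!: derivative_eq_intros continuous_intros simp: frechet_derivative_works)

lemma C_k_on_1_scaleR:
  assumes "C_k_on 1 f UNIV" "C_k_on 1 F UNIV"
  shows "C_k_on 1 (\<lambda>x. f x *\<^sub>R F x) UNIV"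
proof (rule C_k_on_1_UNIV_I)
  show "((\<lambda>x. f x *\<^sub>R F x) has_derivative
     (\<lambda>v. f x *\<^sub>R frechet_derivative F (at x) v + frechet_derivative f (at x) v *\<^sub>R F x)) (at x)" for x
    using assms by (auto intro!: derivative_eq_intros simp: frechet_derivative_works)
  show "continuous_on UNIV
     (\<lambda>x. f x *\<^sub>R frechet_derivative F (at x) v + frechet_derivative f (at x) v *\<^sub>R F x)" for v
    using assms C_k_on_continuous_on[OF assms(1)] C_k_on_continuous_on[OF assms(2)]
    by (auto intro!: continuous_intros)
qed

lemma C_k_on_1_const: "C_k_on 1 (\<lambda>x. c) UNIV"
  by (rule C_k_on_1_UNIV_I[where F' = "\<lambda>x v. 0"]) auto

lemma C_k_on_1_sum:
  assumes "\<And>i. i \<in> I \<Longrightarrow> C_k_on 1 (F i) UNIV"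
  shows "C_k_on 1 (\<lambda>x. \<Sum>i\<in>I. F i x) UNIV"
  using assms
proof (induction I rule: infinite_finite_induct)
  case (insert i I)
  then have "C_k_on 1 (\<lambda>x. F i x + (\<Sum>i\<in>I. F i x)) UNIV"
    by (intro C_k_on_1_add) auto
  with insert show ?case by simp
qed (use C_k_on_1_const in auto)

lemma C_k_on_1_gradient:
  assumes "C_k_on 2 f UNIV"
  shows "C_k_on 1 (gradient f) UNIV"
  unfolding gradient_def[abs_def] using assms
  by (intro C_k_on_1_sum C_k_on_1_scaleR C_k_on_1_const) (auto simp: numeral_2_eq_2)

lemma C_k_on_2_imp_1: "C_k_on 2 f UNIV \<Longrightarrow> C_k_on 1 f UNIV"
  by (metis C_k_on.simps(2) C_k_on_continuous_on One_nat_def Suc_1 C_k_on.simps(1))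

text \<open>Restriction to lines makes one-variable results available: the fundamental theorem of
  calculus on cubes, Taylor's formula, and time derivatives of space-time functions.\<close>

lemma has_vector_derivative_along_line:
  assumes "f differentiable (at (x + s *\<^sub>R v))"
  shows "((\<lambda>s. f (x + s *\<^sub>R v)) has_vector_derivative frechet_derivative f (at (x + s *\<^sub>R v)) v) (at s)"
proof -
  have *: "(f has_derivative frechet_derivative f (at (x + s *\<^sub>R v))) (at (x + s *\<^sub>R v))"
    using assms by (simp add: frechet_derivative_works)
  have lin: "linear (frechet_derivative f (at (x + s *\<^sub>R v)))"
    using * has_derivative_linear by blast
  have "((\<lambda>s. x + s *\<^sub>R v) has_derivative (\<lambda>s. s *\<^sub>R v)) (at s)"
    by (auto intro!: derivative_eq_intros)
  from has_derivative_compose[OF this *]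
  show ?thesis
    by (simp add: has_vector_derivative_def linear_cmul[OF lin])
qed

lemmas has_real_derivative_along_line =
  has_vector_derivative_along_line[where 'b = real, folded has_real_derivative_iff_has_vector_derivative]

section \<open>Rules for gradient and divergence\<close>

lemma gradient_inner:
  assumes "f differentiable (at x)"
  shows "gradient f x \<bullet> v = frechet_derivative f (at x) v"
proof -
  have "linear (frechet_derivative f (at x))"
    using assms linear_frechet_derivative by blast
  then have "frechet_derivative f (at x) (\<Sum>b\<in>Basis. (v \<bullet> b) *\<^sub>R b)
      = (\<Sum>b\<in>Basis. (v \<bullet> b) * frechet_derivative f (at x) b)"
    by (simp add: linear_sum linear_cmul)
  then show ?thesis
    unfolding euclidean_representation
    by (simp add: gradient_def inner_sum_left inner_commute[of v] mult.commute)
qed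

lemma gradient_eqI:
  assumes "(f has_derivative (\<lambda>v. w \<bullet> v)) (at x)"
  shows "gradient f x = w"
  unfolding gradient_def frechet_derivative_at[OF assms, symmetric]
  by (simp add: euclidean_representation)

lemma divergence_eqI:
  assumes "(F has_derivative F') (at x)"
  shows "divergence F x = (\<Sum>b\<in>Basis. F' b \<bullet> b)"
  unfolding divergence_def frechet_derivative_at[OF assms, symmetric] ..

lemma divergence_scaleR:
  assumes "f differentiable (at x)" "F differentiable (at x)"
  shows "divergence (\<lambda>x. f x *\<^sub>R F x) x = f x * divergence F x + gradient f x \<bullet> F x"
proof -
  have "((\<lambda>x. f x *\<^sub>R F x) has_derivative
     (\<lambda>v. f x *\<^sub>R frechet_derivative F (at x) v + frechet_derivative f (at x) v *\<^sub>R F x)) (at x)"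
    using assms by (auto intro!: derivative_eq_intros simp: frechet_derivative_works)
  from divergence_eqI[OF this] show ?thesis
    by (simp add: inner_commute[of "F x"] divergence_def gradient_def sum.distrib inner_sum_left
        sum_distrib_left inner_add_left)
qed

lemma divergence_add:
  assumes "F differentiable (at x)" "G differentiable (at x)"
  shows "divergence (\<lambda>x. F x + G x) x = divergence F x + divergence G x"
proof -
  have "((\<lambda>x. F x + G x) has_derivative
     (\<lambda>v. frechet_derivative F (at x) v + frechet_derivative G (at x) v)) (at x)"
    using assms by (auto intro!: derivative_eq_intros simp: frechet_derivative_works)
  from divergence_eqI[OF this] show ?thesis
    by (simp add: divergence_def sum.distrib inner_add_left)
qed

lemma continuous_on_divergence:
  assumes "C_k_on 1 F UNIV"
  shows "continuous_on UNIV (divergence F)"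
  unfolding divergence_def[abs_def] using assms by (auto intro!: continuous_intros)

lemma continuous_on_gradient:
  assumes "C_k_on 1 f UNIV"
  shows "continuous_on UNIV (gradient f)"
  unfolding gradient_def[abs_def] using assms by (auto intro!: continuous_intros)

section \<open>The divergence theorem on cubes\<close>

definition cube :: "real \<Rightarrow> 'a::euclidean_space set" where
  "cube R = cbox (- R *\<^sub>R One) (R *\<^sub>R One)"

lemma mem_cube: "x \<in> cube R \<longleftrightarrow> (\<forall>b\<in>Basis. x \<bullet> b \<in> {-R..R})"
  by (simp add: cube_def mem_box)

lemma compact_cube: "compact (cube R)"
  by (simp add: cube_def)

lemma cube_measurable [measurable]: "cube R \<in> sets borel"
  by (simp add: cube_def)

lemma set_integrable_cube:
  fixes f :: "'a::euclidean_space \<Rightarrow> real"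
  assumes "continuous_on UNIV f"
  shows "set_integrable lborel (cube R) f"
  unfolding set_integrable_def
  by (rule borel_integrable_compact[OF compact_cube continuous_on_subset[OF assms subset_UNIV]])

text \<open>Changing one coordinate in the product space is moving along a line in direction
  \<open>b\<close>. This joins the iterated integral to the line derivatives and to the
  parametrization of faces in \<open>cube_flux\<close>.\<close>

lemma sum_fun_upd_Basis:
  assumes "b \<in> Basis"
  shows "(\<Sum>j\<in>Basis. (y(b := s)) j *\<^sub>R j) = (\<Sum>j\<in>Basis - {b}. y j *\<^sub>R j) + s *\<^sub>R (b::'a::euclidean_space)"
proof -
  have "(\<Sum>j\<in>Basis. (y(b := s)) j *\<^sub>R j) = s *\<^sub>R b + (\<Sum>j\<in>Basis - {b}. (y(b := s)) j *\<^sub>R j)"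
    using assms by (subst sum.remove[of _ b]) auto
  also have "(\<Sum>j\<in>Basis - {b}. (y(b := s)) j *\<^sub>R j) = (\<Sum>j\<in>Basis - {b}. y j *\<^sub>R j)"
    by (rule sum.cong) auto
  finally show ?thesis by simp
qed

text \<open>That \<open>y\<close> lies in the space of the product measure makes it extensional, as
  membership in the face demands; the rest is reading off coordinates.\<close>

lemma face_in_cube_iff:
  fixes b :: "'a::euclidean_space"
  assumes b: "b \<in> Basis" and y: "y \<in> space (\<Pi>\<^sub>M j\<in>Basis - {b}. lborel)"
  shows "(\<Sum>j\<in>Basis - {b}. y j *\<^sub>R j) + s *\<^sub>R b \<in> cube R \<longleftrightarrow>
    y \<in> (\<Pi>\<^sub>E j\<in>Basis - {b}. {-R..R}) \<and> s \<in> {-R..R}"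
proof -
  have "((\<Sum>j\<in>Basis - {b}. y j *\<^sub>R j) + s *\<^sub>R b) \<bullet> i = (y(b := s)) i" if "i \<in> Basis" for i
    using that unfolding sum_fun_upd_Basis[OF b, symmetric] by simp
  then show ?thesis
    using b y by (auto simp: mem_cube space_PiM PiE_iff Ball_def)
qed

text \<open>Fubini splits off the coordinate \<open>b\<close>, and the fundamental theorem of
  calculus evaluates the inner integral as a difference of values on two opposite faces.\<close>

lemma lborel_integral_cube_partial:
  fixes f f' :: "'a::euclidean_space \<Rightarrow> real"
  assumes b: "b \<in> Basis" and R: "0 \<le> R"
    and deriv: "\<And>x s. ((\<lambda>s. f (x + s *\<^sub>R b)) has_real_derivative f' (x + s *\<^sub>R b)) (at s)"
    and cont: "continuous_on UNIV f'"
  shows "(LINT x:cube R|lborel. f' x) =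
    (LINT y:(\<Pi>\<^sub>E j\<in>Basis - {b}. {-R..R})|(\<Pi>\<^sub>M j\<in>Basis - {b}. lborel).
        f ((\<Sum>j\<in>Basis - {b}. y j *\<^sub>R j) + R *\<^sub>R b)
      - f ((\<Sum>j\<in>Basis - {b}. y j *\<^sub>R j) - R *\<^sub>R b))"
proof -
  interpret product_sigma_finite "\<lambda>j::'a. lborel :: real measure" ..
  define h where "h x = indicator (cube R) x *\<^sub>R f' x" for x
  define P where "P = (\<Pi>\<^sub>M j\<in>Basis - {b}. lborel :: real measure)"
  define z where "z y = (\<Sum>j\<in>Basis - {b}. y j *\<^sub>R j)" for y :: "'a \<Rightarrow> real"
  have Basis: "insert b (Basis - {b}) = (Basis :: 'a set)" using b by auto
  have inth: "integrable lborel h" unfolding h_def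
    using continuous_on_subset[OF cont] compact_cube by (intro borel_integrable_compact) auto
  then have h: "h \<in> borel_measurable borel" by simp
  \<comment> \<open>On a fixed line the indicator of the cube factors into that of the face, which
    depends on \<open>y\<close> only, and that of the interval \<open>{-R..R}\<close>.\<close>
  have inner: "(LINT s|lborel. h (\<Sum>j\<in>Basis. (y(b := s)) j *\<^sub>R j)) =
      indicator (\<Pi>\<^sub>E j\<in>Basis - {b}. {-R..R}) y * (f (z y + R *\<^sub>R b) - f (z y - R *\<^sub>R b))"
    if y: "y \<in> space P" for y
  proof -
    have "h (\<Sum>j\<in>Basis. (y(b := s)) j *\<^sub>R j) =
       indicator (\<Pi>\<^sub>E j\<in>Basis - {b}. {-R..R}) y * (indicator {-R..R} s *\<^sub>R f' (z y + s *\<^sub>R b))" for s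
      using face_in_cube_iff[OF b y[unfolded P_def], of s R]
      unfolding sum_fun_upd_Basis[OF b] h_def z_def by (auto simp: indicator_def)
    moreover have "(LINT s|lborel. indicator {-R..R} s *\<^sub>R f' (z y + s *\<^sub>R b))
        = f (z y + R *\<^sub>R b) - f (z y + (- R) *\<^sub>R b)"
      using R deriv
      by (intro integral_FTC_atLeastAtMost)
         (auto intro!: continuous_intros continuous_on_compose2[OF cont]
           simp: has_real_derivative_iff_has_vector_derivative[symmetric] has_field_derivative_at_within)
    ultimately show ?thesis by simp
  qed
  have "(LINT x:cube R|lborel. f' x) = integral\<^sup>L lborel h"
    unfolding set_lebesgue_integral_def h_def[abs_def] ..
  \<comment> \<open>Lebesgue measure is the image of the product measure under the map from
    coordinates to points.\<close>
  also have "\<dots> = integral\<^sup>L (\<Pi>\<^sub>M j\<in>Basis. lborel) (\<lambda>y. h (\<Sum>j\<in>Basis. y j *\<^sub>R j))"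
    unfolding lborel_eq[where 'a = 'a] by (rule integral_distr) (use h in simp_all)
  also have "\<dots> = (LINT y|P. (LINT s|lborel. h (\<Sum>j\<in>Basis. (y(b := s)) j *\<^sub>R j)))"
  proof -
    have "integrable (\<Pi>\<^sub>M j\<in>Basis. lborel) (\<lambda>y. h (\<Sum>j\<in>Basis. y j *\<^sub>R j))"
      using inth unfolding lborel_eq[where 'a = 'a] by (rule integrable_distr[rotated]) simp
    moreover have "finite (Basis - {b})" "b \<notin> Basis - {b}" by simp_all
    ultimately show ?thesis
      using product_integral_insert[of "Basis - {b}" b "\<lambda>y. h (\<Sum>j\<in>Basis. y j *\<^sub>R j)"]
      unfolding P_def Basis by blast
  qed
  also have "\<dots> = (LINT y|P. indicator (\<Pi>\<^sub>E j\<in>Basis - {b}. {-R..R}) y * (f (z y + R *\<^sub>R b) - f (z y - R *\<^sub>R b)))"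
    by (rule Bochner_Integration.integral_cong[OF refl]) (rule inner)
  finally show ?thesis by (simp add: set_lebesgue_integral_def P_def z_def)
qed

lemma cube_divergence:
  fixes F :: "'a::euclidean_space \<Rightarrow> 'a"
  assumes F: "C_k_on 1 F UNIV" and R: "0 \<le> R"
  shows "(LINT x:cube R|lborel. divergence F x) = cube_flux F R"
proof -
  have "(LINT x:cube R|lborel. divergence F x) =
      (\<Sum>b\<in>Basis. LINT x:cube R|lborel. frechet_derivative F (at x) b \<bullet> b)"
    unfolding divergence_def set_lebesgue_integral_def scaleR_sum_right
  proof (rule Bochner_Integration.integral_sum)
    fix b :: 'a
    have "continuous_on UNIV (\<lambda>x. frechet_derivative F (at x) b \<bullet> b)"
      using F by (auto intro!: continuous_intros)
    from set_integrable_cube[OF this]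
    show "integrable lborel (\<lambda>x. indicator (cube R) x *\<^sub>R (frechet_derivative F (at x) b \<bullet> b))"
      by (simp add: set_integrable_def)
  qed
  also have "\<dots> = cube_flux F R"
    unfolding cube_flux_def
  proof (intro sum.cong refl lborel_integral_cube_partial R)
    fix b x :: 'a and s :: real
    show "((\<lambda>s. F (x + s *\<^sub>R b) \<bullet> b) has_real_derivative frechet_derivative F (at (x + s *\<^sub>R b)) b \<bullet> b) (at s)"
      unfolding has_real_derivative_iff_has_vector_derivative
      using F
      by (intro bounded_linear.has_vector_derivative[OF bounded_linear_inner_left]
            has_vector_derivative_along_line) auto
  qed (use F in \<open>auto intro!: continuous_intros\<close>)
  finally show ?thesis .
qed

section \<open>Nonnegative functions near their zeros\<close>

text \<open>With \<open>w = sqrt z\<close> the logarithm is \<open>2 * ln w\<close>. For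
  \<open>w \<ge> 1\<close> use \<open>ln w \<le> w - 1\<close>; for smaller \<open>w\<close>,
  \<open>- ln w = ln (1 / w)\<close> is at most \<open>1 / w - 1\<close>, and the factor
  \<open>w\<close> cancels \<open>1 / w\<close>. The right side is bounded near 0, so the estimate
  is uniform over bounded ranges of \<open>z\<close>.\<close>

lemma sqrt_mult_abs_ln_le:
  fixes z :: real
  assumes "0 \<le> z"
  shows "sqrt z * \<bar>ln z\<bar> \<le> 2 + z\<^sup>2"
proof (cases "z = 0")
  case False
  define w where "w = sqrt z"
  have w: "0 < w" and z: "z = w\<^sup>2" using assms False by (auto simp: w_def)
  have lnz: "ln z = 2 * ln w" using w by (simp add: z ln_realpow)
  show ?thesis
  proof (cases "1 \<le> w")
    case True
    then have "0 \<le> ln w" "ln w \<le> w - 1" using w ln_le_minus_one by auto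
    then have "w * \<bar>ln z\<bar> \<le> w * (2 * w)" unfolding lnz using w by (intro mult_left_mono) auto
    also have "\<dots> = 2 * z" by (simp add: z power2_eq_square)
    also have "\<dots> \<le> 2 + z\<^sup>2" using zero_le_power2[of "z - 1"] by (simp add: power2_diff)
    finally show ?thesis by (simp add: w_def)
  next
    case False
    have "- ln w = ln (1 / w)" using w by (simp add: ln_div)
    also have "\<dots> \<le> 1 / w - 1" using w by (intro ln_le_minus_one) auto
    finally have "\<bar>ln w\<bar> \<le> 1 / w" using False w by simp
    then have "w * \<bar>ln z\<bar> \<le> w * (2 * (1 / w))" unfolding lnz using w by (intro mult_left_mono) auto
    then show ?thesis using w by (simp add: w_def add_increasing2)
  qed
qed simp

lemma tendsto_sqrt_mult_ln_0:
  fixes p :: "'b \<Rightarrow> real"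
  assumes lim: "(p \<longlongrightarrow> 0) F" and nonneg: "\<forall>\<^sub>F x in F. 0 \<le> p x"
  shows "((\<lambda>x. sqrt (p x) * ln (p x)) \<longlongrightarrow> 0) F"
proof (rule Lim_null_comparison)
  have "norm (sqrt z * ln z) \<le> 2 * sqrt (sqrt z) * (2 + z)" if "0 \<le> z" for z :: real
  proof (cases "z = 0")
    case False
    with that have "0 < z" by simp
    \<comment> \<open>Splitting the square root frees a factor \<open>sqrt (sqrt z)\<close>, which
      tends to 0 with \<open>z\<close>, while the preceding estimate at \<open>sqrt z\<close> bounds
      the rest.\<close>
    have "sqrt z * \<bar>ln z\<bar> = 2 * sqrt (sqrt z) * (sqrt (sqrt z) * \<bar>ln (sqrt z)\<bar>)"
      using \<open>0 < z\<close> by (simp add: ln_sqrt)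
    also have "\<dots> \<le> 2 * sqrt (sqrt z) * (2 + (sqrt z)\<^sup>2)"
      using that by (intro mult_left_mono sqrt_mult_abs_ln_le) auto
    finally show ?thesis using that by (simp add: abs_mult)
  qed simp
  then show "\<forall>\<^sub>F x in F. norm (sqrt (p x) * ln (p x)) \<le> 2 * sqrt (sqrt (p x)) * (2 + p x)"
    using nonneg by (auto elim: eventually_mono)
  have "((\<lambda>x. 2 * sqrt (sqrt (p x)) * (2 + p x)) \<longlongrightarrow> 2 * sqrt (sqrt 0) * (2 + 0)) F"
    by (intro tendsto_intros lim)
  then show "((\<lambda>x. 2 * sqrt (sqrt (p x)) * (2 + p x)) \<longlongrightarrow> 0) F" by simp
qed

section \<open>Square-root bounds for derivatives of nonnegative functions\<close>

lemma taylor2_bound: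
  fixes f :: "real \<Rightarrow> real"
  assumes f: "\<And>s. \<bar>s\<bar> \<le> \<delta> \<Longrightarrow> (f has_real_derivative f' s) (at s)"
    and f': "\<And>s. \<bar>s\<bar> \<le> \<delta> \<Longrightarrow> (f' has_real_derivative f'' s) (at s)"
    and B: "\<And>s. \<bar>s\<bar> \<le> \<delta> \<Longrightarrow> \<bar>f'' s\<bar> \<le> B"
    and h: "\<bar>h\<bar> \<le> \<delta>"
  shows "\<bar>f h - f 0 - f' 0 * h\<bar> \<le> B * h\<^sup>2 / 2"
proof (cases "h = 0")
  case False
  \<comment> \<open>All orders from 2 on are sent to \<open>f''\<close>; the formula reaches only
    order 2.\<close>
  define diff where "diff m = (if m = 0 then f else if m = 1 then f' else f'')" for m :: nat
  have "\<exists>t. (if h < 0 then h < t \<and> t < 0 else 0 < t \<and> t < h) \<and>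
      f h = (\<Sum>m<2. (diff m 0 / fact m) * (h - 0) ^ m) + (diff 2 t / fact 2) * (h - 0) ^ 2"
  proof (rule Taylor[where a = "- \<delta>" and b = \<delta>])
    show "\<forall>m t. m < 2 \<and> - \<delta> \<le> t \<and> t \<le> \<delta> \<longrightarrow> (diff m has_real_derivative diff (Suc m) t) (at t)"
      using f f' by (auto simp: diff_def less_2_cases_iff)
  qed (use h False in \<open>auto simp: diff_def\<close>)
  then obtain t where between: "if h < 0 then h < t \<and> t < 0 else 0 < t \<and> t < h"
    and eq: "f h = (\<Sum>m<2. (diff m 0 / fact m) * (h - 0) ^ m) + (diff 2 t / fact 2) * (h - 0) ^ 2"
    by blast
  from between have t: "\<bar>t\<bar> \<le> \<delta>" using h by (auto split: if_splits)
  have "f h - f 0 - f' 0 * h = f'' t * (h\<^sup>2 / 2)"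
    using eq by (simp add: diff_def numeral_2_eq_2)
  then have "\<bar>f h - f 0 - f' 0 * h\<bar> = \<bar>f'' t\<bar> * h\<^sup>2 / 2"
    by (simp only: abs_mult) simp
  also have "\<dots> \<le> B * h\<^sup>2 / 2"
    using B[OF t] by (intro divide_right_mono mult_right_mono) auto
  finally show ?thesis .
qed simp

text \<open>Nonnegativity of \<open>f\<close> forces the Taylor parabola lying above it to be
  nonnegative at its minimum, which reads \<open>(f' 0)\<^sup>2 \<le> 2 * N * f 0\<close>. On a
  bounded interval the curvature \<open>N\<close> must be large enough to keep that minimum
  inside.\<close>

lemma deriv_le_sqrt:
  fixes f :: "real \<Rightarrow> real"
  assumes \<delta>: "0 < \<delta>"
    and f: "\<And>s. \<bar>s\<bar> \<le> \<delta> \<Longrightarrow> (f has_real_derivative f' s) (at s)"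
    and f': "\<And>s. \<bar>s\<bar> \<le> \<delta> \<Longrightarrow> (f' has_real_derivative f'' s) (at s)"
    and B: "\<And>s. \<bar>s\<bar> \<le> \<delta> \<Longrightarrow> \<bar>f'' s\<bar> \<le> B"
    and nonneg: "\<And>s. \<bar>s\<bar> \<le> \<delta> \<Longrightarrow> 0 \<le> f s"
    and D: "\<bar>f' 0\<bar> \<le> D"
  shows "\<bar>f' 0\<bar> \<le> sqrt (2 * (B + D / \<delta> + 1)) * sqrt (f 0)"
proof -
  \<comment> \<open>\<open>B\<close> keeps the parabola above \<open>f\<close>,
    \<open>D / \<delta>\<close> keeps its minimum point within \<open>\<delta>\<close> of 0, and 1
    makes \<open>N\<close> positive.\<close>
  define N where "N = B + D / \<delta> + 1"
  have B0: "0 \<le> B" using B[of 0] \<delta> by simp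
  have D0: "0 \<le> D" using D by simp
  have N: "0 < N" "B \<le> N" "D / \<delta> \<le> N" using B0 D0 \<delta> by (auto simp: N_def add_nonneg_pos)
  \<comment> \<open>the minimum point of the Taylor parabola, where nonnegativity of \<open>f\<close> is most restrictive\<close>
  define h where "h = - f' 0 / N"
  have "\<bar>h\<bar> \<le> D / N" using D N by (simp add: h_def divide_right_mono)
  also have "\<dots> \<le> \<delta>" using N \<delta> by (simp add: field_simps)
  finally have h: "\<bar>h\<bar> \<le> \<delta>" .
  have "0 \<le> f 0 + f' 0 * h + B * h\<^sup>2 / 2"
    using nonneg[OF h] abs_le_D1[OF taylor2_bound[OF f f' B h]] by linarith
  also have "B * h\<^sup>2 / 2 \<le> N * h\<^sup>2 / 2" using N by (intro divide_right_mono mult_right_mono) auto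
  also have "f 0 + f' 0 * h + N * h\<^sup>2 / 2 = f 0 - (f' 0)\<^sup>2 / (2 * N)"
    using N by (simp add: h_def power2_eq_square field_simps)
  finally have "(f' 0)\<^sup>2 \<le> 2 * N * f 0" using N by (simp add: field_simps)
  then have "sqrt ((f' 0)\<^sup>2) \<le> sqrt (2 * N * f 0)" by (rule real_sqrt_le_mono)
  then show ?thesis by (simp add: real_sqrt_mult N_def)
qed

text \<open>The one-variable bound is applied on segments in direction \<open>v\<close> through the
  points of \<open>K\<close>; compactness makes their length and the bounds on first and second
  derivatives uniform. \<open>S\<close> may be a space-time domain and \<open>v\<close> its time
  direction.\<close>

lemma frechet_derivative_le_sqrt:
  fixes f :: "'a::euclidean_space \<Rightarrow> real"
  assumes f: "C_k_on 2 f S" and nonneg: "\<And>x. x \<in> S \<Longrightarrow> 0 \<le> f x"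
    and S: "open S" and K: "compact K" "K \<subseteq> S"
  obtains C where "0 \<le> C" "\<And>x. x \<in> K \<Longrightarrow> \<bar>frechet_derivative f (at x) v\<bar> \<le> C * sqrt (f x)"
proof -
  obtain e where e: "0 < e" "(\<Union>x\<in>K. ball x e) \<subseteq> S"
    using compact_subset_open_imp_ball_epsilon_subset[OF K(1) S K(2)] by blast
  \<comment> \<open>Segments of this half-length reach at most \<open>e / 2\<close> away from
    \<open>K\<close>; the summand 1 covers \<open>v = 0\<close>.\<close>
  define \<delta> where "\<delta> = e / (2 * (norm v + 1))"
  have \<delta>: "0 < \<delta>" using e by (simp add: \<delta>_def add_nonneg_pos)
  \<comment> \<open>All points swept by the segments: a compact set, hence a common domain for the
    bounds \<open>B\<close> and \<open>D\<close>.\<close>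
  define L where "L = (\<lambda>(x, s). x + s *\<^sub>R v) ` (K \<times> {-\<delta>..\<delta>})"
  have L: "compact L"
    unfolding L_def using K(1)
    by (intro compact_continuous_image compact_Times) (auto simp: case_prod_beta intro!: continuous_intros)
  have mem_L: "x + s *\<^sub>R v \<in> L" if "x \<in> K" "\<bar>s\<bar> \<le> \<delta>" for x s
    using that unfolding L_def by force
  have "x + s *\<^sub>R v \<in> S" if x: "x \<in> K" and s: "\<bar>s\<bar> \<le> \<delta>" for x s
  proof -
    have "norm (s *\<^sub>R v) \<le> \<delta> * norm v" using s by (simp add: mult_right_mono)
    also have "\<dots> \<le> e / 2"
    proof -
      have "norm v / (norm v + 1) \<le> 1" by (simp add: add_nonneg_pos)
      from mult_left_mono[OF this, of "e / 2"] show ?thesis using e by (simp add: \<delta>_def)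
    qed
    finally have "x + s *\<^sub>R v \<in> ball x e" using e by (simp add: dist_norm)
    then show ?thesis using e x by blast
  qed
  then have LS: "L \<subseteq> S" by (auto simp: L_def)
  define g where "g = (\<lambda>x. frechet_derivative f (at x) v)"
  define h where "h = (\<lambda>x. frechet_derivative g (at x) v)"
  have f_diff: "f differentiable (at x)" and g_diff: "g differentiable (at x)" if "x \<in> S" for x
    using f that by (auto simp: numeral_2_eq_2 g_def)
  have h_cont: "continuous_on S h" using f by (auto simp: numeral_2_eq_2 h_def g_def)
  have g_cont: "continuous_on S g"
    by (meson g_diff continuous_at_imp_continuous_on differentiable_imp_continuous_within)
  obtain B where B: "0 < B" "\<And>x. x \<in> L \<Longrightarrow> \<bar>h x\<bar> \<le> B"
    using compact_imp_bounded[OF compact_continuous_image[OF continuous_on_subset[OF h_cont LS] L]]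
    by (auto simp: bounded_pos)
  obtain D where D: "0 < D" "\<And>x. x \<in> L \<Longrightarrow> \<bar>g x\<bar> \<le> D"
    using compact_imp_bounded[OF compact_continuous_image[OF continuous_on_subset[OF g_cont LS] L]]
    by (auto simp: bounded_pos)
  show thesis
  proof
    show "0 \<le> sqrt (2 * (B + D / \<delta> + 1))" using B D \<delta> by auto
    fix x assume x: "x \<in> K"
    have line: "x + s *\<^sub>R v \<in> S" if "\<bar>s\<bar> \<le> \<delta>" for s using mem_L[OF x that] LS by auto
    have "\<bar>g (x + 0 *\<^sub>R v)\<bar> \<le> sqrt (2 * (B + D / \<delta> + 1)) * sqrt (f (x + 0 *\<^sub>R v))"
    proof (rule deriv_le_sqrt[OF \<delta>])
      fix s assume s: "\<bar>s\<bar> \<le> \<delta>"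
      show "((\<lambda>s. f (x + s *\<^sub>R v)) has_real_derivative g (x + s *\<^sub>R v)) (at s)"
        unfolding g_def by (intro has_real_derivative_along_line f_diff line s)
      show "((\<lambda>s. g (x + s *\<^sub>R v)) has_real_derivative h (x + s *\<^sub>R v)) (at s)"
        unfolding h_def by (intro has_real_derivative_along_line g_diff line s)
      show "\<bar>h (x + s *\<^sub>R v)\<bar> \<le> B" by (intro B(2) mem_L x s)
      show "0 \<le> f (x + s *\<^sub>R v)" by (intro nonneg line s)
    next
      show "\<bar>g (x + 0 *\<^sub>R v)\<bar> \<le> D" by (rule D(2)[OF mem_L[OF x]]) (use \<delta> in simp)
    qed
    then show "\<bar>frechet_derivative f (at x) v\<bar> \<le> sqrt (2 * (B + D / \<delta> + 1)) * sqrt (f x)"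
      by (simp add: g_def)
  qed
qed

text \<open>Only a zero of \<open>f\<close> is delicate. It is an interior minimum, so
  \<open>f'\<close> vanishes there and \<open>f\<close> is at most quadratic nearby. Up to sign, the
  difference quotient is the bounded \<open>sqrt f / \<bar>h\<bar>\<close> times
  \<open>sqrt f * ln f\<close>, which tends to 0. The claimed value is then 0 whatever
  \<open>ln 0\<close> is.\<close>

lemma has_real_derivative_mult_ln:
  fixes f :: "real \<Rightarrow> real"
  assumes T: "open T" "t \<in> T"
    and f: "\<And>s. s \<in> T \<Longrightarrow> (f has_real_derivative f' s) (at s)"
    and f': "\<And>s. s \<in> T \<Longrightarrow> (f' has_real_derivative f'' s) (at s)"
    and f'': "continuous_on T f''"
    and nonneg: "\<And>s. s \<in> T \<Longrightarrow> 0 \<le> f s"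
  shows "((\<lambda>s. f s * ln (f s)) has_real_derivative (ln (f t) + 1) * f' t) (at t)"
proof (cases "f t = 0")
  case False
  then have "0 < f t" using nonneg[OF T(2)] by simp
  then show ?thesis
    by (auto intro!: derivative_eq_intros f T simp: field_simps)
next
  case True
  obtain e where e: "0 < e" "cball t e \<subseteq> T"
    using T open_contains_cball by blast
  then have mem: "t + s \<in> T" if "\<bar>s\<bar> \<le> e" for s
    using that by (auto simp: dist_norm subset_iff)
  obtain B where B: "0 < B" "\<And>s. s \<in> cball t e \<Longrightarrow> \<bar>f'' s\<bar> \<le> B"
    using compact_imp_bounded[OF compact_continuous_image[OF continuous_on_subset[OF f'' e(2)] compact_cball]]
    by (auto simp: bounded_pos)
  have f't: "f' t = 0"
    by (rule DERIV_local_min[OF f[OF T(2)] e(1)])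
      (use True nonneg e in \<open>auto simp: subset_iff dist_norm\<close>)
  have bound: "f (t + h) \<le> B * h\<^sup>2 / 2" if h: "\<bar>h\<bar> \<le> e" for h
  proof -
    have "\<bar>f (t + h) - f (t + 0) - f' (t + 0) * h\<bar> \<le> B * h\<^sup>2 / 2"
    proof (rule taylor2_bound[where f = "\<lambda>h. f (t + h)" and f' = "\<lambda>h. f' (t + h)" and \<delta> = e])
      fix s :: real assume s: "\<bar>s\<bar> \<le> e"
      show "((\<lambda>h. f (t + h)) has_real_derivative f' (t + s)) (at s)"
        using f[OF mem[OF s]] DERIV_shift[of f _ s t] by (simp add: add.commute)
      show "((\<lambda>h. f' (t + h)) has_real_derivative f'' (t + s)) (at s)"
        using f'[OF mem[OF s]] DERIV_shift[of f' _ s t] by (simp add: add.commute)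
      show "\<bar>f'' (t + s)\<bar> \<le> B" using s by (intro B) (simp add: dist_norm)
    qed (rule h)
    then show ?thesis using True f't by simp
  qed
  have ev: "\<forall>\<^sub>F h in at 0. \<bar>h\<bar> \<le> e"
    using e unfolding eventually_at by (auto intro!: exI[of _ e])
  have lim: "((\<lambda>h. f (t + h)) \<longlongrightarrow> 0) (at 0)"
    using DERIV_isCont[OF f[OF T(2)]] True by (simp add: isCont_iff)
  have "((\<lambda>h. sqrt (B / 2) * \<bar>sqrt (f (t + h)) * ln (f (t + h))\<bar>) \<longlongrightarrow> sqrt (B / 2) * \<bar>0\<bar>) (at 0)"
    using ev nonneg mem
    by (intro tendsto_intros tendsto_sqrt_mult_ln_0 lim) (auto elim!: eventually_mono)
  moreover have "\<forall>\<^sub>F h in at 0. norm ((f (t + h) * ln (f (t + h)) - f t * ln (f t)) / h)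
      \<le> sqrt (B / 2) * \<bar>sqrt (f (t + h)) * ln (f (t + h))\<bar>"
    using ev eventually_neq_at_within[of "0::real" 0 UNIV]
  proof eventually_elim
    case (elim h)
    have nn: "0 \<le> f (t + h)" using nonneg mem elim by auto
    have "sqrt (f (t + h)) \<le> sqrt (B / 2 * h\<^sup>2)"
      using bound[of h] elim by (intro real_sqrt_le_mono) auto
    then have "sqrt (f (t + h)) / \<bar>h\<bar> \<le> sqrt (B / 2)"
      using elim by (simp add: real_sqrt_mult real_sqrt_divide field_simps)
    then have "sqrt (f (t + h)) / \<bar>h\<bar> * \<bar>sqrt (f (t + h)) * ln (f (t + h))\<bar>
       \<le> sqrt (B / 2) * \<bar>sqrt (f (t + h)) * ln (f (t + h))\<bar>"
      by (rule mult_right_mono) simp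
    moreover have "sqrt (f (t + h)) / \<bar>h\<bar> * \<bar>sqrt (f (t + h)) * ln (f (t + h))\<bar>
       = \<bar>f (t + h) * ln (f (t + h))\<bar> / \<bar>h\<bar>"
      using nn by (simp add: abs_mult mult.assoc[symmetric])
    ultimately show ?case
      unfolding True by (simp only: mult_zero_left diff_zero real_norm_def abs_divide)
  qed
  ultimately have "((\<lambda>h. (f (t + h) * ln (f (t + h)) - f t * ln (f t)) / h) \<longlongrightarrow> 0) (at 0)"
    by (simp only: abs_zero mult_zero_right) (rule Lim_null_comparison)
  then show ?thesis by (simp add: DERIV_def f't)
qed

section \<open>Integration by parts against the logarithm\<close>

text \<open>Dominated convergence on each pair of opposite faces: these have finite measure, and the
  two face values together contribute at most \<open>2 * K\<close>.\<close>

lemma cube_flux_tendsto: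
  fixes F :: "nat \<Rightarrow> 'a::euclidean_space \<Rightarrow> 'a"
  assumes R: "0 \<le> R"
    and F [measurable]: "\<And>n. F n \<in> borel_measurable borel"
    and G [measurable]: "G \<in> borel_measurable borel"
    and lim: "\<And>x. x \<in> cube R \<Longrightarrow> (\<lambda>n. F n x) \<longlonglongrightarrow> G x"
    and bound: "\<And>n x. x \<in> cube R \<Longrightarrow> norm (F n x) \<le> K"
  shows "(\<lambda>n. cube_flux (F n) R) \<longlonglongrightarrow> cube_flux G R"
  unfolding cube_flux_def set_lebesgue_integral_def
proof (intro tendsto_sum integral_dominated_convergence)
  fix b :: 'a assume b: "b \<in> Basis"
  interpret product_sigma_finite "\<lambda>j::'a. lborel :: real measure" ..
  let ?P = "\<Pi>\<^sub>M j\<in>Basis - {b}. lborel :: real measure"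
  let ?B = "\<Pi>\<^sub>E j\<in>Basis - {b}. {-R..R}"
  define z where "z y = (\<Sum>j\<in>Basis - {b}. y j *\<^sub>R j)" for y :: "'a \<Rightarrow> real"
  have B [measurable]: "?B \<in> sets ?P" by (intro sets_PiM_I_finite) auto
  have [measurable]: "z \<in> ?P \<rightarrow>\<^sub>M borel" unfolding z_def by measurable
  have meas: "(\<lambda>y. indicator ?B y *\<^sub>R (H (z y + R *\<^sub>R b) \<bullet> b - H (z y - R *\<^sub>R b) \<bullet> b)) \<in> borel_measurable ?P"
    if [measurable]: "H \<in> borel_measurable borel" for H
    by measurable
  show "(\<lambda>y. indicator ?B y *\<^sub>R (F n ((\<Sum>j\<in>Basis - {b}. y j *\<^sub>R j) + R *\<^sub>R b) \<bullet> b
      - F n ((\<Sum>j\<in>Basis - {b}. y j *\<^sub>R j) - R *\<^sub>R b) \<bullet> b)) \<in> borel_measurable ?P" for n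
    using meas[OF F] by (simp add: z_def)
  show "(\<lambda>y. indicator ?B y *\<^sub>R (G ((\<Sum>j\<in>Basis - {b}. y j *\<^sub>R j) + R *\<^sub>R b) \<bullet> b
      - G ((\<Sum>j\<in>Basis - {b}. y j *\<^sub>R j) - R *\<^sub>R b) \<bullet> b)) \<in> borel_measurable ?P"
    using meas[OF G] by (simp add: z_def)
  have "emeasure ?P ?B < \<infinity>"
    by (subst emeasure_PiM) (auto simp: R less_top[symmetric] power_eq_top_ennreal)
  then show "integrable ?P (\<lambda>y. indicator ?B y * (2 * K))"
    using B by (intro integrable_mult_left integrable_real_indicator) auto
  have face: "z y + R *\<^sub>R b \<in> cube R" "z y - R *\<^sub>R b \<in> cube R" if "y \<in> ?B" "y \<in> space ?P" for y
    using face_in_cube_iff[OF b that(2), of R R] face_in_cube_iff[OF b that(2), of "- R" R] that(1) R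
    by (auto simp: z_def)
  show "AE y in ?P. (\<lambda>n. indicator ?B y *\<^sub>R (F n ((\<Sum>j\<in>Basis - {b}. y j *\<^sub>R j) + R *\<^sub>R b) \<bullet> b
      - F n ((\<Sum>j\<in>Basis - {b}. y j *\<^sub>R j) - R *\<^sub>R b) \<bullet> b)) \<longlonglongrightarrow>
    indicator ?B y *\<^sub>R (G ((\<Sum>j\<in>Basis - {b}. y j *\<^sub>R j) + R *\<^sub>R b) \<bullet> b
      - G ((\<Sum>j\<in>Basis - {b}. y j *\<^sub>R j) - R *\<^sub>R b) \<bullet> b)"
  proof (rule AE_I2)
    fix y assume "y \<in> space ?P"
    then show "(\<lambda>n. indicator ?B y *\<^sub>R (F n ((\<Sum>j\<in>Basis - {b}. y j *\<^sub>R j) + R *\<^sub>R b) \<bullet> b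
        - F n ((\<Sum>j\<in>Basis - {b}. y j *\<^sub>R j) - R *\<^sub>R b) \<bullet> b)) \<longlonglongrightarrow>
      indicator ?B y *\<^sub>R (G ((\<Sum>j\<in>Basis - {b}. y j *\<^sub>R j) + R *\<^sub>R b) \<bullet> b
        - G ((\<Sum>j\<in>Basis - {b}. y j *\<^sub>R j) - R *\<^sub>R b) \<bullet> b)"
      using face[of y] unfolding z_def
      by (cases "y \<in> ?B") (auto intro!: tendsto_intros lim)
  qed
  have component: "\<bar>F n x \<bullet> b\<bar> \<le> K" if "x \<in> cube R" for n x
    using Basis_le_norm[OF b, of "F n x"] bound[OF that, of n] by simp
  show "AE y in ?P. norm (indicator ?B y *\<^sub>R (F n ((\<Sum>j\<in>Basis - {b}. y j *\<^sub>R j) + R *\<^sub>R b) \<bullet> b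
      - F n ((\<Sum>j\<in>Basis - {b}. y j *\<^sub>R j) - R *\<^sub>R b) \<bullet> b)) \<le> indicator ?B y * (2 * K)" for n
  proof (rule AE_I2)
    fix y assume y: "y \<in> space ?P"
    show "norm (indicator ?B y *\<^sub>R (F n ((\<Sum>j\<in>Basis - {b}. y j *\<^sub>R j) + R *\<^sub>R b) \<bullet> b
      - F n ((\<Sum>j\<in>Basis - {b}. y j *\<^sub>R j) - R *\<^sub>R b) \<bullet> b)) \<le> indicator ?B y * (2 * K)"
    proof (cases "y \<in> ?B")
      case True
      show ?thesis
        using component[OF face(1)[OF True y], of n] component[OF face(2)[OF True y], of n] True
        unfolding z_def by simp
    qed simp
  qed
qed

text \<open>
  The field \<open>ln p *\<^sub>R J\<close> need not be differentiable where \<open>p\<close> vanishes, so the divergence theorem is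
  applied to \<open>ln (p + \<epsilon>) *\<^sub>R J\<close> and \<open>\<epsilon>\<close> sent to 0; the bounds by \<open>sqrt p\<close> make everything dominated.
\<close>

lemma cube_flux_ln:
  fixes p :: "'a::euclidean_space \<Rightarrow> real" and J :: "'a \<Rightarrow> 'a"
  assumes p: "C_k_on 1 p UNIV" and J: "C_k_on 1 J UNIV"
    and nonneg: "\<And>x. 0 \<le> p x" and R: "0 \<le> R" and C: "0 \<le> C"
    and J_le: "\<And>x. x \<in> cube R \<Longrightarrow> norm (J x) \<le> C * sqrt (p x)"
    and div_le: "\<And>x. x \<in> cube R \<Longrightarrow> \<bar>divergence J x\<bar> \<le> C * sqrt (p x)"
    and grad_le: "\<And>x. x \<in> cube R \<Longrightarrow> norm (gradient p x) \<le> C * sqrt (p x)"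
  shows "set_integrable lborel (cube R) (\<lambda>x. ln (p x) * divergence J x + gradient p x \<bullet> J x / p x)"
    and "(LINT x:cube R|lborel. ln (p x) * divergence J x + gradient p x \<bullet> J x / p x)
      = cube_flux (\<lambda>x. ln (p x) *\<^sub>R J x) R"
proof -
  define F where "F e x = ln (p x + e) *\<^sub>R J x" for e x
  \<comment> \<open>The divergence of \<open>F e\<close> by the product rule; at
    \<open>e = 0\<close> it becomes the integrand of the claim.\<close>
  define d where "d e x = ln (p x + e) * divergence J x + gradient p x \<bullet> J x / (p x + e)" for e x
  \<comment> \<open>Bounded by 1, so that \<open>p x + \<epsilon> n\<close> stays below
    \<open>M + 1\<close> on the cube, whence the constant \<open>K\<close>.\<close>
  define \<epsilon> where "\<epsilon> n = inverse (real (Suc n))" for n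
  have \<epsilon>: "0 < \<epsilon> n" "\<epsilon> n \<le> 1" for n
    by (auto simp: \<epsilon>_def field_simps)
  have \<epsilon>_lim: "\<epsilon> \<longlonglongrightarrow> 0" unfolding \<epsilon>_def by (rule LIMSEQ_inverse_real_of_nat)
  note cont = C_k_on_continuous_on[OF p] C_k_on_continuous_on[OF J]
    continuous_on_divergence[OF J] continuous_on_gradient[OF p]
  note [measurable] = cont[THEN borel_measurable_continuous_onI]
  have J_diff: "J differentiable (at x)" and p_diff: "p differentiable (at x)" for x
    using p J by auto
  have ln_deriv: "((\<lambda>x. ln (p x + e)) has_derivative (\<lambda>v. frechet_derivative p (at x) v / (p x + e))) (at x)"
    if "0 < e" for e x
    using p_diff[of x] nonneg[of x] that
    by (auto intro!: derivative_eq_intros simp: frechet_derivative_works add_nonneg_pos field_simps)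
  have pos: "p x + e \<noteq> 0" if "0 < e" for e x using nonneg[of x] that by simp
  have ln_C1: "C_k_on 1 (\<lambda>x. ln (p x + e)) UNIV" if e: "0 < e" for e
  proof (rule C_k_on_1_UNIV_I[OF ln_deriv[OF e]])
    show "continuous_on UNIV (\<lambda>x. frechet_derivative p (at x) v / (p x + e))" for v
      using p pos[OF e] cont(1) by (intro continuous_intros) auto
  qed
  have F_C1: "C_k_on 1 (F e) UNIV" if "0 < e" for e
    unfolding F_def by (intro C_k_on_1_scaleR ln_C1 J that)
  have div_F: "divergence (F e) x = d e x" if e: "0 < e" for e x
  proof -
    have "((\<lambda>x. ln (p x + e)) has_derivative (\<lambda>v. (gradient p x /\<^sub>R (p x + e)) \<bullet> v)) (at x)"
      using ln_deriv[OF e, of x] by (simp add: gradient_inner[OF p_diff] divide_inverse mult.commute)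
    then have "gradient (\<lambda>x. ln (p x + e)) x = gradient p x /\<^sub>R (p x + e)"
      by (rule gradient_eqI)
    moreover have "(\<lambda>x. ln (p x + e)) differentiable (at x)"
      using ln_deriv[OF e] by (auto simp: differentiable_def)
    ultimately show ?thesis
      unfolding F_def d_def using J_diff
      by (subst divergence_scaleR) (auto simp: divide_inverse mult.commute)
  qed
  have "bounded (p ` cube R)"
    using compact_continuous_image[OF continuous_on_subset[OF cont(1) subset_UNIV] compact_cube]
      compact_imp_bounded by blast
  then obtain M where M: "0 < M" "\<And>x. x \<in> cube R \<Longrightarrow> p x \<le> M"
    by (force simp: bounded_pos)
  define K where "K = 2 + (M + 1)\<^sup>2"
  have K: "0 \<le> K" by (simp add: K_def)
  have sqrt_ln_le: "sqrt (p x) * \<bar>ln (p x + \<epsilon> n)\<bar> \<le> K" if "x \<in> cube R" for x n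
  proof -
    have "sqrt (p x) * \<bar>ln (p x + \<epsilon> n)\<bar> \<le> sqrt (p x + \<epsilon> n) * \<bar>ln (p x + \<epsilon> n)\<bar>"
      using \<epsilon>[of n] by (intro mult_right_mono) auto
    also have "\<dots> \<le> 2 + (p x + \<epsilon> n)\<^sup>2"
      using nonneg[of x] \<epsilon>[of n] by (intro sqrt_mult_abs_ln_le) auto
    also have "\<dots> \<le> K"
      unfolding K_def using M(2)[OF that] \<epsilon>[of n] nonneg[of x] by (intro add_left_mono power_mono) auto
    finally show ?thesis .
  qed
  have ln_bound: "\<bar>ln (p x + \<epsilon> n)\<bar> * a \<le> C * K" if x: "x \<in> cube R" and a: "a \<le> C * sqrt (p x)" for x n a
  proof -
    have "\<bar>ln (p x + \<epsilon> n)\<bar> * a \<le> \<bar>ln (p x + \<epsilon> n)\<bar> * (C * sqrt (p x))"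
      using a by (intro mult_left_mono) auto
    also have "\<dots> = C * (sqrt (p x) * \<bar>ln (p x + \<epsilon> n)\<bar>)" by simp
    also have "\<dots> \<le> C * K" by (intro mult_left_mono sqrt_ln_le x C)
    finally show ?thesis .
  qed
  have F_bound: "norm (F (\<epsilon> n) x) \<le> C * K" if "x \<in> cube R" for n x
    using ln_bound[OF that J_le[OF that], of n] by (simp add: F_def)
  have d_bound: "\<bar>d (\<epsilon> n) x\<bar> \<le> C * K + C\<^sup>2" if x: "x \<in> cube R" for n x
  proof -
    \<comment> \<open>Both factors carry \<open>sqrt (p x)\<close>, so their product is of order
      \<open>p x\<close> and absorbs the denominator uniformly in \<open>n\<close>.\<close>
    have "\<bar>gradient p x \<bullet> J x\<bar> \<le> norm (gradient p x) * norm (J x)" by (rule Cauchy_Schwarz_ineq2)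
    also have "\<dots> \<le> (C * sqrt (p x)) * (C * sqrt (p x))"
      using C nonneg[of x] by (intro mult_mono grad_le J_le x) auto
    also have "\<dots> = C\<^sup>2 * p x" using nonneg[of x] by (simp add: power2_eq_square)
    also have "\<dots> \<le> C\<^sup>2 * (p x + \<epsilon> n)" using \<epsilon>[of n] by (intro mult_left_mono) auto
    finally have "\<bar>gradient p x \<bullet> J x / (p x + \<epsilon> n)\<bar> \<le> C\<^sup>2"
      using nonneg[of x] \<epsilon>[of n] by (simp add: divide_le_eq)
    moreover have "\<bar>ln (p x + \<epsilon> n) * divergence J x\<bar> \<le> C * K"
      using ln_bound[OF x div_le[OF x], of n] by (simp add: abs_mult)
    ultimately show ?thesis unfolding d_def by linarith
  qed
  \<comment> \<open>At zeros of \<open>p\<close> all three fields vanish, so every approximant is 0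
    there, and so is the claimed limit whatever \<open>ln 0\<close> is.\<close>
  have zero: "J x = 0" "divergence J x = 0" "gradient p x = 0" if "x \<in> cube R" "p x = 0" for x
    using J_le[OF that(1)] div_le[OF that(1)] grad_le[OF that(1)] that(2) by auto
  have p_lim: "(\<lambda>n. p x + \<epsilon> n) \<longlonglongrightarrow> p x" for x
    using tendsto_add[OF tendsto_const \<epsilon>_lim, of "p x"] by simp
  have F_lim: "(\<lambda>n. F (\<epsilon> n) x) \<longlonglongrightarrow> ln (p x) *\<^sub>R J x" if "x \<in> cube R" for x
  proof (cases "p x = 0")
    case False
    then show ?thesis unfolding F_def by (intro tendsto_intros p_lim)
  qed (simp add: F_def zero that)
  have d_lim: "(\<lambda>n. d (\<epsilon> n) x) \<longlonglongrightarrow> ln (p x) * divergence J x + gradient p x \<bullet> J x / p x"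
    if "x \<in> cube R" for x
  proof (cases "p x = 0")
    case False
    then show ?thesis unfolding d_def by (intro tendsto_intros p_lim)
  qed (simp add: d_def zero that)
  let ?f = "\<lambda>x. indicator (cube R) x *\<^sub>R (ln (p x) * divergence J x + gradient p x \<bullet> J x / p x)"
  let ?s = "\<lambda>n x. indicator (cube R) x *\<^sub>R d (\<epsilon> n) x"
  let ?w = "\<lambda>x::'a. indicator (cube R) x *\<^sub>R (C * K + C\<^sup>2)"
  have meas: "?f \<in> borel_measurable lborel" "\<And>n. ?s n \<in> borel_measurable lborel"
    unfolding d_def by measurable
  have w: "integrable lborel ?w"
    using set_integrable_cube[of "\<lambda>x. C * K + C\<^sup>2" R] unfolding set_integrable_def by simp
  have lim: "AE x in lborel. (\<lambda>n. ?s n x) \<longlonglongrightarrow> ?f x"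
    by (rule AE_I2) (auto simp: indicator_def intro: d_lim)
  have bound: "AE x in lborel. norm (?s n x) \<le> ?w x" for n
    by (rule AE_I2) (auto simp: indicator_def d_bound)
  show "set_integrable lborel (cube R) (\<lambda>x. ln (p x) * divergence J x + gradient p x \<bullet> J x / p x)"
    unfolding set_integrable_def by (rule integrable_dominated_convergence[OF meas w lim bound])
  have "(\<lambda>n. LINT x:cube R|lborel. d (\<epsilon> n) x) \<longlonglongrightarrow>
      (LINT x:cube R|lborel. ln (p x) * divergence J x + gradient p x \<bullet> J x / p x)"
    unfolding set_lebesgue_integral_def by (rule integral_dominated_convergence[OF meas w lim bound])
  moreover have "(LINT x:cube R|lborel. d (\<epsilon> n) x) = cube_flux (F (\<epsilon> n)) R" for n
    using cube_divergence[OF F_C1[OF \<epsilon>(1)] R] by (simp add: div_F[OF \<epsilon>(1)])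
  moreover have "(\<lambda>n. cube_flux (F (\<epsilon> n)) R) \<longlonglongrightarrow> cube_flux (\<lambda>x. ln (p x) *\<^sub>R J x) R"
    by (rule cube_flux_tendsto[OF R _ _ F_lim F_bound]) (auto simp: F_def)
  ultimately show "(LINT x:cube R|lborel. ln (p x) * divergence J x + gradient p x \<bullet> J x / p x)
      = cube_flux (\<lambda>x. ln (p x) *\<^sub>R J x) R"
    using LIMSEQ_unique by simp
qed

section \<open>Entropy balance\<close>

text \<open>The mean value theorem carries the domination of the derivative over to the difference
  quotients, and dominated convergence along every null sequence gives the derivative. Measurability
  of \<open>f' t\<close> comes from its being a pointwise limit.\<close>

lemma has_real_derivative_integral_dominated:
  fixes f :: "real \<Rightarrow> 'b \<Rightarrow> real"
  assumes T: "open T" "t \<in> T"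
    and int: "\<And>s. s \<in> T \<Longrightarrow> integrable M (f s)"
    and deriv: "\<And>s x. s \<in> T \<Longrightarrow> ((\<lambda>r. f r x) has_real_derivative f' s x) (at s)"
    and \<epsilon>: "0 < \<epsilon>" and g: "integrable M g"
    and bound: "\<And>s x. s \<in> T \<Longrightarrow> dist s t < \<epsilon> \<Longrightarrow> \<bar>f' s x\<bar> \<le> g x"
  shows "integrable M (f' t)"
    and "((\<lambda>s. LINT x|M. f s x) has_real_derivative (LINT x|M. f' t x)) (at t)"
proof -
  obtain e0 where e0: "0 < e0" "ball t e0 \<subseteq> T"
    using T open_contains_ball by blast
  \<comment> \<open>Within this radius the intermediate points of the mean value theorem stay in
    \<open>T\<close> and in the range of the domination.\<close>
  define e where "e = min e0 \<epsilon>"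
  have e: "0 < e" and mem: "\<And>s. \<bar>s - t\<bar> < e \<Longrightarrow> s \<in> T \<and> dist s t < \<epsilon>"
    using e0 \<epsilon> by (auto simp: e_def dist_norm subset_iff abs_minus_commute)
  define q where "q h x = (f (t + h) x - f t x) / h" for h x
  have q_le: "\<bar>q h x\<bar> \<le> g x" if h: "h \<noteq> 0" "\<bar>h\<bar> < e" for h x
  proof -
    have "\<exists>z. \<bar>z - t\<bar> < e \<and> f (t + h) x - f t x = h * f' z x"
    proof (cases "0 < h")
      case True
      have "\<exists>z>t. z < t + h \<and> f (t + h) x - f t x = (t + h - t) * f' z x"
        by (rule MVT2) (use True h mem deriv in auto)
      then obtain z where "t < z" "z < t + h" "f (t + h) x - f t x = (t + h - t) * f' z x" by blast
      then show ?thesis using h by (intro exI[of _ z]) auto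
    next
      case False
      have "\<exists>z>t + h. z < t \<and> f t x - f (t + h) x = (t - (t + h)) * f' z x"
        by (rule MVT2) (use False h mem deriv in auto)
      then obtain z where "t + h < z" "z < t" "f t x - f (t + h) x = (t - (t + h)) * f' z x" by blast
      then show ?thesis using h by (intro exI[of _ z]) auto
    qed
    then obtain z where "\<bar>z - t\<bar> < e" "f (t + h) x - f t x = h * f' z x" by blast
    then show ?thesis using h(1) bound mem by (simp add: q_def)
  qed
  have q_lim: "((\<lambda>h. q h x) \<longlongrightarrow> f' t x) (at 0)" for x
    using deriv[OF T(2)] by (simp add: DERIV_def q_def)
  have q_int: "integrable M (q h)" if "\<bar>h\<bar> < e" for h
    unfolding q_def[abs_def] using int T mem[of "t + h"] that by simp
  have main: "integrable M (f' t) \<and> (\<lambda>n. LINT x|M. q (X n) x) \<longlonglongrightarrow> (LINT x|M. f' t x)"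
    if X: "X \<longlonglongrightarrow> 0" "\<And>n. X n \<noteq> 0" for X
  proof -
    \<comment> \<open>A null sequence enters the radius \<open>e\<close> only eventually, so
      convergence is shown for a tail and shifted back.\<close>
    obtain N where "\<And>n. n \<ge> N \<Longrightarrow> \<bar>X n\<bar> < e"
      using LIMSEQ_D[OF X(1) e] by auto
    then have N: "\<bar>X (n + N)\<bar> < e" for n by simp
    have lim: "(\<lambda>n. q (X (n + N)) x) \<longlonglongrightarrow> f' t x" for x
      using q_lim[of x] X LIMSEQ_ignore_initial_segment[OF X(1), of N]
      unfolding tendsto_at_iff_sequentially o_def by auto
    have meas: "(\<lambda>x. q (X (n + N)) x) \<in> borel_measurable M" for n
      using q_int[OF N] by auto
    have meas': "f' t \<in> borel_measurable M"
      by (rule borel_measurable_LIMSEQ_real[OF lim meas])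
    have bnd: "AE x in M. norm (q (X (n + N)) x) \<le> g x" for n
      using q_le[OF X(2) N] by simp
    note dct = meas' meas g AE_I2[OF lim] bnd
    have "(\<lambda>n. LINT x|M. q (X (n + N)) x) \<longlonglongrightarrow> (LINT x|M. f' t x)"
      by (rule integral_dominated_convergence[OF dct])
    then show ?thesis
      using integrable_dominated_convergence[OF dct] LIMSEQ_offset[of "\<lambda>n. LINT x|M. q (X n) x" N] by auto
  qed
  show "integrable M (f' t)"
    using main[of "\<lambda>n. 1 / real (Suc n)"] LIMSEQ_inverse_real_of_nat by (auto simp: inverse_eq_divide)
  have "((\<lambda>h. LINT x|M. q h x) \<longlongrightarrow> (LINT x|M. f' t x)) (at 0)"
    unfolding tendsto_at_iff_sequentially o_def using main by auto
  moreover have "\<forall>\<^sub>F h in at 0. (LINT x|M. q h x) = ((LINT x|M. f (t + h) x) - (LINT x|M. f t x)) / h"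
  proof (rule eventually_mono)
    show "\<forall>\<^sub>F h in at 0. \<bar>h\<bar> < e"
      using e unfolding eventually_at by (auto intro!: exI[of _ e])
    fix h assume "\<bar>h\<bar> < e"
    then have "integrable M (f (t + h))" "integrable M (f t)" using int T mem[of "t + h"] by auto
    then show "(LINT x|M. q h x) = ((LINT x|M. f (t + h) x) - (LINT x|M. f t x)) / h"
      unfolding q_def by simp
  qed
  ultimately show "((\<lambda>s. LINT x|M. f s x) has_real_derivative (LINT x|M. f' t x)) (at t)"
    unfolding DERIV_def by (rule Lim_transform_eventually)
qed

text \<open>Induction on \<open>k\<close> by the chain rule. The function has to vary, since the
  induction hypothesis is applied to the derivatives of \<open>f\<close> in the spatial directions
  \<open>(0, v)\<close>.\<close>

lemma C_k_on_slice:
  assumes "C_k_on k f (T \<times> UNIV)" "t \<in> T"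
  shows "C_k_on k (\<lambda>x. f (t, x)) UNIV"
  using assms(1)
proof (induction k arbitrary: f)
  case 0
  then show ?case
    using assms(2) by (auto intro!: continuous_on_compose2[of "T \<times> UNIV" f] continuous_intros)
next
  case (Suc k)
  have deriv: "((\<lambda>x. f (t, x)) has_derivative (\<lambda>v. frechet_derivative f (at (t, x)) (0, v))) (at x)" for x
  proof (rule has_derivative_compose[of "Pair t" "Pair 0"])
    show "(Pair t has_derivative Pair 0) (at x)"
      by (auto intro!: derivative_eq_intros)
    show "(f has_derivative frechet_derivative f (at (t, x))) (at (t, x))"
      using assms(2) by (intro C_k_on_has_derivative[OF Suc.prems]) auto
  qed
  have "C_k_on k (\<lambda>x. frechet_derivative f (at (t, x)) (0, v)) UNIV" for v
    using Suc.prems Suc.IH[of "\<lambda>z. frechet_derivative f (at z) (0, v)"] by simp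
  moreover have "frechet_derivative (\<lambda>x. f (t, x)) (at x) = (\<lambda>v. frechet_derivative f (at (t, x)) (0, v))" for x
    by (rule frechet_derivative_at[OF deriv, symmetric])
  moreover have "(\<lambda>x. f (t, x)) differentiable (at x)" for x
    using deriv differentiable_def by blast
  ultimately show ?case by simp
qed

lemma has_real_derivative_time_slice:
  assumes "f differentiable (at (t, x))"
  shows "((\<lambda>s. f (s, x)) has_real_derivative frechet_derivative f (at (t, x)) (1, 0)) (at t)"
  using has_real_derivative_along_line[of f "(0, x)" t "(1, 0)"] assms by simp

text \<open>The square-root bound on the compact set \<open>{x}\<close> forces every partial
  derivative to vanish.\<close>

lemma gradient_eq_0_of_zero:
  assumes "C_k_on 2 p UNIV" "\<And>x. 0 \<le> p x" "p x = 0"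
  shows "gradient p x = 0"
proof -
  have "frechet_derivative p (at x) b = 0" for b
  proof -
    obtain C where "\<And>y. y \<in> {x} \<Longrightarrow> \<bar>frechet_derivative p (at y) b\<bar> \<le> C * sqrt (p y)"
      by (rule frechet_derivative_le_sqrt[OF assms(1), of "{x}" b]) (use assms(2) in auto)
    then show ?thesis using assms(3) by fastforce
  qed
  then show ?thesis by (simp add: gradient_def)
qed

lemma gradient_le_sqrt_on_cube:
  fixes p :: "'a::euclidean_space \<Rightarrow> real"
  assumes "C_k_on 2 p UNIV" "\<And>x. 0 \<le> p x"
  obtains C where "0 \<le> C" "\<And>x. x \<in> cube R \<Longrightarrow> norm (gradient p x) \<le> C * sqrt (p x)"
proof -
  have "\<exists>C\<ge>0. \<forall>x\<in>cube R. \<bar>frechet_derivative p (at x) b\<bar> \<le> C * sqrt (p x)" for b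
    by (rule frechet_derivative_le_sqrt[OF assms(1) _ _ compact_cube[of R], of b]) (use assms(2) in auto)
  then obtain C where C: "\<And>b. 0 \<le> C b"
      "\<And>b x. x \<in> cube R \<Longrightarrow> \<bar>frechet_derivative p (at x) b\<bar> \<le> C b * sqrt (p x)"
    by metis
  show thesis
  proof
    show "0 \<le> (\<Sum>b\<in>Basis. C b)" by (intro sum_nonneg C)
    fix x :: 'a assume x: "x \<in> cube R"
    have "norm (gradient p x) \<le> (\<Sum>b\<in>Basis. \<bar>frechet_derivative p (at x) b\<bar>)"
      unfolding gradient_def by (rule sum_norm_le) simp
    also have "\<dots> \<le> (\<Sum>b\<in>Basis. C b) * sqrt (p x)"
      unfolding sum_distrib_right by (intro sum_mono C x)
    finally show "norm (gradient p x) \<le> (\<Sum>b\<in>Basis. C b) * sqrt (p x)" .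
  qed
qed

text \<open>
  Where \<open>p\<close> vanishes, both sides are 0: the left one whatever the junk value of the gradient,
  the right one by division by 0.
\<close>

lemma norm_gradient_ln:
  assumes "C_k_on 2 p UNIV" "\<And>x. 0 \<le> p x"
  shows "p x * (norm (gradient (\<lambda>x. ln (p x)) x))\<^sup>2 = gradient p x \<bullet> gradient p x / p x"
proof (cases "p x = 0")
  case False
  with assms(2) have pos: "0 < p x" by (simp add: order_less_le)
  have diff: "p differentiable (at x)" using assms(1) by (simp add: numeral_2_eq_2)
  have "((\<lambda>x. ln (p x)) has_derivative (\<lambda>v. (gradient p x /\<^sub>R p x) \<bullet> v)) (at x)"
    using diff pos
    by (auto intro!: derivative_eq_intros simp: gradient_inner frechet_derivative_works divide_inverse)
  then have "gradient (\<lambda>x. ln (p x)) x = gradient p x /\<^sub>R p x"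
    by (rule gradient_eqI)
  then show ?thesis
    using pos unfolding power2_norm_eq_inner by (simp add: field_simps power2_eq_square)
qed (simp add: gradient_eq_0_of_zero assms)

text \<open>Both integrations by parts at one fixed time. The terms are collected in
  \<open>h\<close> before passing to the whole space: there the products
  \<open>gradient p x \<bullet> gradient U x\<close> cancel, and only terms of known integrability
  remain. On a cube the integral of \<open>h\<close> is a combination of three fluxes, which vanish
  in the limit.\<close>

lemma entropy_balance:
  fixes U p :: "'a::euclidean_space \<Rightarrow> real" and \<beta> :: real
  defines "J \<equiv> \<lambda>x. p x *\<^sub>R gradient U x + \<beta> *\<^sub>R gradient p x"
  assumes U: "C_k_on 2 U UNIV" and p: "C_k_on 2 p UNIV" and nonneg: "\<And>x. 0 \<le> p x"
    and div_le: "\<And>R. \<exists>C\<ge>0. \<forall>x\<in>cube R. \<bar>divergence J x\<bar> \<le> C * sqrt (p x)"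
    and int_J: "integrable lborel (\<lambda>x. (ln (p x) + 1) * divergence J x)"
    and int_U: "integrable lborel (\<lambda>x. p x * laplacian U x)"
    and int_F: "integrable lborel (\<lambda>x. \<beta> * (p x * (norm (gradient (\<lambda>x. ln (p x)) x))\<^sup>2))"
    and bd_J: "no_boundary_term J"
    and bd_ln: "no_boundary_term (\<lambda>x. ln (p x) *\<^sub>R J x)"
    and bd_U: "no_boundary_term (\<lambda>x. p x *\<^sub>R gradient U x)"
  shows "(LINT x|lborel. (ln (p x) + 1) * divergence J x) =
    (LINT x|lborel. p x * laplacian U x)
    - \<beta> * (LINT x|lborel. p x * (norm (gradient (\<lambda>x. ln (p x)) x))\<^sup>2)"
proof -
  define h where "h x = (ln (p x) + 1) * divergence J x - p x * laplacian U x
    + \<beta> * (p x * (norm (gradient (\<lambda>x. ln (p x)) x))\<^sup>2)" for x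
  have int_h: "integrable lborel h"
    unfolding h_def[abs_def] using int_J int_U int_F by simp
  note p1 = C_k_on_2_imp_1[OF p]
  note gU = C_k_on_1_gradient[OF U] and gp = C_k_on_1_gradient[OF p]
  have pU: "C_k_on 1 (\<lambda>x. p x *\<^sub>R gradient U x) UNIV"
    by (intro C_k_on_1_scaleR p1 gU)
  have J: "C_k_on 1 J UNIV"
    unfolding J_def by (intro C_k_on_1_add C_k_on_1_scaleR C_k_on_1_const p1 gU gp)
  have div_pU: "divergence (\<lambda>x. p x *\<^sub>R gradient U x) x = p x * laplacian U x + gradient p x \<bullet> gradient U x" for x
    unfolding laplacian_def using p1 gU by (intro divergence_scaleR) auto
  have on_cube: "(LINT x:cube R|lborel. h x) =
      cube_flux (\<lambda>x. ln (p x) *\<^sub>R J x) R + cube_flux J R - cube_flux (\<lambda>x. p x *\<^sub>R gradient U x) R"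
    if R: "0 \<le> R" for R
  proof -
    obtain C1 where C1: "0 \<le> C1" "\<And>x. x \<in> cube R \<Longrightarrow> norm (gradient p x) \<le> C1 * sqrt (p x)"
      using gradient_le_sqrt_on_cube[OF p nonneg] by blast
    obtain C2 where C2: "0 \<le> C2" "\<And>x. x \<in> cube R \<Longrightarrow> \<bar>divergence J x\<bar> \<le> C2 * sqrt (p x)"
      using div_le[of R] by blast
    have "continuous_on UNIV (\<lambda>x. sqrt (p x) * norm (gradient U x))"
      using C_k_on_continuous_on[OF p] C_k_on_continuous_on[OF gU] by (intro continuous_intros)
    from compact_imp_bounded[OF compact_continuous_image[OF continuous_on_subset[OF this subset_UNIV] compact_cube[of R]]]
    obtain C3 where C3: "0 < C3" "\<And>x. x \<in> cube R \<Longrightarrow> sqrt (p x) * norm (gradient U x) \<le> C3"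
      by (force simp: bounded_pos)
    \<comment> \<open>One constant for the gradient, divergence and flux bounds, as
      \<open>cube_flux_ln\<close> takes a single \<open>C\<close>.\<close>
    define C where "C = C1 + C2 + (C3 + \<bar>\<beta>\<bar> * C1)"
    have C: "0 \<le> C" "C1 \<le> C" "C2 \<le> C" "C3 + \<bar>\<beta>\<bar> * C1 \<le> C"
      using C1(1) C2(1) C3(1) by (auto simp: C_def)
    have le_C: "a \<le> C * sqrt (p x)" if "a \<le> c * sqrt (p x)" "c \<le> C" for a c x
      using that(1) mult_right_mono[OF that(2), of "sqrt (p x)"] nonneg[of x] by simp
    have J_le: "norm (J x) \<le> C * sqrt (p x)" if x: "x \<in> cube R" for x
    proof (rule le_C[OF _ C(4)])
      \<comment> \<open>Writing \<open>p x\<close> as a product of two square roots leaves one in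
        front of a factor that is bounded on the cube.\<close>
      have "norm (J x) \<le> sqrt (p x) * (sqrt (p x) * norm (gradient U x)) + \<bar>\<beta>\<bar> * norm (gradient p x)"
        unfolding J_def using norm_triangle_ineq[of "p x *\<^sub>R gradient U x" "\<beta> *\<^sub>R gradient p x"] nonneg[of x]
        by (simp add: mult.assoc[symmetric])
      also have "\<dots> \<le> sqrt (p x) * C3 + \<bar>\<beta>\<bar> * (C1 * sqrt (p x))"
        using nonneg[of x] by (intro add_mono mult_left_mono C3 C1 x) auto
      finally show "norm (J x) \<le> (C3 + \<bar>\<beta>\<bar> * C1) * sqrt (p x)" by (simp add: algebra_simps)
    qed
    note ln_J = cube_flux_ln[OF p1 J nonneg R C(1) J_le le_C[OF C2(2) C(3)] le_C[OF C1(2) C(2)]]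
    have int_div: "set_integrable lborel (cube R) (divergence J)"
      "set_integrable lborel (cube R) (divergence (\<lambda>x. p x *\<^sub>R gradient U x))"
      by (intro set_integrable_cube continuous_on_divergence J pU)+
    \<comment> \<open>Where \<open>p\<close> vanishes so does its gradient, and both sides reduce to
      \<open>(ln (p x) + 1) * divergence J x\<close>.\<close>
    have "h x = (ln (p x) * divergence J x + gradient p x \<bullet> J x / p x) + divergence J x
        - divergence (\<lambda>x. p x *\<^sub>R gradient U x) x" for x
    proof (cases "p x = 0")
      case True
      then show ?thesis
        by (simp add: h_def div_pU gradient_eq_0_of_zero[OF p nonneg])
    next
      case False
      then have "gradient p x \<bullet> J x / p x = gradient p x \<bullet> gradient U x + \<beta> * (gradient p x \<bullet> gradient p x / p x)"
        by (simp add: J_def inner_add_right add_divide_distrib)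
      then show ?thesis
        by (simp add: h_def div_pU norm_gradient_ln[OF p nonneg] algebra_simps)
    qed
    then have "(LINT x:cube R|lborel. h x) =
      (LINT x:cube R|lborel. ln (p x) * divergence J x + gradient p x \<bullet> J x / p x)
      + (LINT x:cube R|lborel. divergence J x)
      - (LINT x:cube R|lborel. divergence (\<lambda>x. p x *\<^sub>R gradient U x) x)"
      using ln_J(1) int_div by (simp add: set_integral_add set_integral_diff)
    then show ?thesis
      by (simp add: ln_J(2) cube_divergence[OF J R] cube_divergence[OF pU R])
  qed
  have "(\<lambda>n. LINT x:cube (real n)|lborel. h x) \<longlonglongrightarrow> 0"
  proof -
    have "(\<lambda>n. cube_flux (\<lambda>x. ln (p x) *\<^sub>R J x) (real n) + cube_flux J (real n)
        - cube_flux (\<lambda>x. p x *\<^sub>R gradient U x) (real n)) \<longlonglongrightarrow> 0 + 0 - 0"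
      using bd_J bd_ln bd_U unfolding no_boundary_term_def
      by (intro tendsto_intros) (erule filterlim_compose[OF _ filterlim_real_sequentially])+
    then show ?thesis by (simp add: on_cube)
  qed
  \<comment> \<open>The cubes exhaust the space and \<open>h\<close> is integrable, so the cube
    integrals also converge to the full one.\<close>
  moreover have "(\<lambda>n. LINT x:cube (real n)|lborel. h x) \<longlonglongrightarrow> (LINT x|lborel. h x)"
    unfolding set_lebesgue_integral_def
  proof (rule integral_dominated_convergence[where w = "\<lambda>x. \<bar>h x\<bar>"])
    show "AE x in lborel. (\<lambda>n. indicator (cube (real n)) x *\<^sub>R h x) \<longlonglongrightarrow> h x"
    proof (rule AE_I2)
      fix x :: 'a
      obtain N where N: "norm x \<le> real N" using real_arch_simple by blast
      have "x \<in> cube (real n)" if "N \<le> n" for n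
        unfolding mem_cube
      proof
        fix b :: 'a assume "b \<in> Basis"
        then have "\<bar>x \<bullet> b\<bar> \<le> real n"
          using Basis_le_norm[of b x] N that by linarith
        then show "x \<bullet> b \<in> {- real n..real n}" by auto
      qed
      then show "(\<lambda>n. indicator (cube (real n)) x *\<^sub>R h x) \<longlonglongrightarrow> h x"
        by (intro tendsto_eventually eventually_sequentiallyI[of N]) simp
    qed
  qed (use int_h in \<open>auto simp: indicator_def\<close>)
  ultimately have "(LINT x|lborel. h x) = 0"
    by (rule LIMSEQ_unique[symmetric])
  \<comment> \<open>The factor \<open>\<beta>\<close> comes out of the integral also when it is 0:
    then the product vanishes whatever the remaining integral is.\<close>
  moreover have "(LINT x|lborel. h x) = (LINT x|lborel. (ln (p x) + 1) * divergence J x)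
      - (LINT x|lborel. p x * laplacian U x)
      + \<beta> * (LINT x|lborel. p x * (norm (gradient (\<lambda>x. ln (p x)) x))\<^sup>2)"
    unfolding h_def using int_J int_U int_F by simp
  ultimately show ?thesis by simp
qed

theorem theorem5:
  fixes L_pred Omega R_dec U :: "'a::euclidean_space \<Rightarrow> real"
    and \<gamma> lam \<beta> :: real
    and T :: "real set"
    and \<rho> :: "real \<Rightarrow> 'a \<Rightarrow> real"
  assumes U_def: "U = potential L_pred Omega R_dec \<gamma> lam"
    and U_C2: "C_k_on 2 U UNIV"
    and beta_nonneg: "\<beta> \<ge> 0"
    and open_T: "open T"
    and density: "\<forall>t\<in>T. prob_density (\<rho> t)"
    and smooth: "smooth_on (\<lambda>(t, \<theta>). \<rho> t \<theta>) (T \<times> UNIV)"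
    and decay: "sufficient_decay T U \<beta> \<rho>"
    and evolution: "fokker_planck_on T U \<beta> \<rho>"
    and t_in: "t \<in> T"
  shows "((\<lambda>s. shannon_entropy (\<rho> s)) has_real_derivative
           - (LINT \<theta>|lborel. \<rho> t \<theta> * laplacian U \<theta>)
           + \<beta> * (LINT \<theta>|lborel. \<rho> t \<theta> * (norm (gradient (\<lambda>x. ln (\<rho> t x)) \<theta>))\<^sup>2)) (at t)"
proof -
  define f where "f = (\<lambda>(t, \<theta>). \<rho> t \<theta>)"
  \<comment> \<open>\<open>g\<close> and \<open>g'\<close> are the first and second time
    derivatives, taken in the space-time direction \<open>(1, 0)\<close>.\<close>
  define g where "g = (\<lambda>z. frechet_derivative f (at z) (1, 0))"
  define g' where "g' = (\<lambda>z. frechet_derivative g (at z) (1, 0))"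
  define J where "J s = (\<lambda>\<theta>. \<rho> s \<theta> *\<^sub>R gradient U \<theta> + \<beta> *\<^sub>R gradient (\<rho> s) \<theta>)" for s
  have f2: "C_k_on 2 f (T \<times> UNIV)" using smooth by (simp add: smooth_on_def f_def)
  have f_nonneg: "0 \<le> f z" if "z \<in> T \<times> UNIV" for z
    using density that by (auto simp: f_def prob_density_def)
  have nonneg: "0 \<le> \<rho> s \<theta>" if "s \<in> T" for s \<theta>
    using density that by (auto simp: prob_density_def)
  have \<rho>2: "C_k_on 2 (\<rho> s) UNIV" if "s \<in> T" for s
    using C_k_on_slice[OF f2 that] by (simp add: f_def)
  have \<rho>_deriv: "((\<lambda>r. \<rho> r \<theta>) has_real_derivative g (s, \<theta>)) (at s)" if "s \<in> T" for s \<theta>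
    using has_real_derivative_time_slice[of f s \<theta>] f2 that by (simp add: numeral_2_eq_2 f_def g_def)
  have g_deriv: "((\<lambda>r. g (r, \<theta>)) has_real_derivative g' (s, \<theta>)) (at s)" if "s \<in> T" for s \<theta>
    using has_real_derivative_time_slice[of g s \<theta>] f2 that by (simp add: numeral_2_eq_2 g_def g'_def)
  have g'_cont: "continuous_on T (\<lambda>s. g' (s, \<theta>))" for \<theta>
  proof (rule continuous_on_compose2[of "T \<times> UNIV" g'])
    show "continuous_on (T \<times> UNIV) g'" using f2 by (simp add: numeral_2_eq_2 g_def g'_def)
  qed (auto intro!: continuous_intros)
  \<comment> \<open>The time derivative provided by smoothness and the one prescribed by the
    evolution agree by uniqueness; the Laplacian is then absorbed into the flux.\<close>
  have g_eq: "g (s, \<theta>) = divergence (J s) \<theta>" if s: "s \<in> T" for s \<theta>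
  proof -
    have "g (s, \<theta>) = divergence (\<lambda>x. \<rho> s x *\<^sub>R gradient U x) \<theta> + \<beta> * laplacian (\<rho> s) \<theta>"
      using evolution s by (intro DERIV_unique[OF \<rho>_deriv[OF s]]) (auto simp: fokker_planck_on_def)
    also have "\<dots> = divergence (J s) \<theta>"
    proof -
      have C1: "C_k_on 1 (gradient (\<rho> s)) UNIV" "C_k_on 1 (\<lambda>x. \<beta> *\<^sub>R gradient (\<rho> s) x) UNIV"
          "C_k_on 1 (\<lambda>x. \<rho> s x *\<^sub>R gradient U x) UNIV"
        by (intro C_k_on_1_scaleR C_k_on_1_const C_k_on_1_gradient C_k_on_2_imp_1 \<rho>2 s U_C2)+
      have "divergence (\<lambda>x. \<beta> *\<^sub>R gradient (\<rho> s) x) \<theta> = \<beta> * laplacian (\<rho> s) \<theta>"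
        unfolding laplacian_def using C1 by (subst divergence_scaleR) (auto simp: gradient_def)
      then show ?thesis
        unfolding J_def using C1 by (subst divergence_add) auto
    qed
    finally show ?thesis .
  qed
  have entropy_deriv: "((\<lambda>r. \<rho> r \<theta> * ln (\<rho> r \<theta>)) has_real_derivative (ln (\<rho> s \<theta>) + 1) * divergence (J s) \<theta>) (at s)"
    if s: "s \<in> T" for s \<theta>
    using has_real_derivative_mult_ln[OF open_T s \<rho>_deriv g_deriv g'_cont nonneg] g_eq[OF s] by simp
  note decay_t = bspec[OF decay[unfolded sufficient_decay_def Let_def] t_in]
  have "\<exists>\<epsilon>>0. \<exists>w. integrable lborel w \<and> (\<forall>s\<in>T. dist s t < \<epsilon> \<longrightarrow>
      (\<forall>\<theta>. \<bar>deriv (\<lambda>r. \<rho> r \<theta> * ln (\<rho> r \<theta>)) s\<bar> \<le> w \<theta>))"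
    using decay_t by (elim conjE)
  then obtain \<epsilon> w where \<epsilon>: "0 < \<epsilon>" and w: "integrable lborel w"
    and dominated: "\<And>s \<theta>. s \<in> T \<Longrightarrow> dist s t < \<epsilon> \<Longrightarrow> \<bar>deriv (\<lambda>r. \<rho> r \<theta> * ln (\<rho> r \<theta>)) s\<bar> \<le> w \<theta>"
    by auto
  \<comment> \<open>The decay condition bounds \<open>deriv\<close>, whose value
    \<open>entropy_deriv\<close> supplies, also at zeros of the density.\<close>
  have w_bound: "\<bar>(ln (\<rho> s \<theta>) + 1) * divergence (J s) \<theta>\<bar> \<le> w \<theta>" if "s \<in> T" "dist s t < \<epsilon>" for s \<theta>
    using dominated[OF that] DERIV_imp_deriv[OF entropy_deriv[OF that(1)]] by simp
  have int_entropy: "integrable lborel (\<lambda>\<theta>. \<rho> s \<theta> * ln (\<rho> s \<theta>))" if "s \<in> T" for s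
    using decay that by (auto simp: sufficient_decay_def)
  note leibniz = has_real_derivative_integral_dominated[OF open_T t_in int_entropy entropy_deriv \<epsilon> w w_bound]
  \<comment> \<open>The divergence involves second spatial derivatives, for which spatial
    nonnegativity gives no square-root bound. Being the time derivative of the density, it inherits
    one from nonnegativity on the open space-time domain.\<close>
  have div_le: "\<exists>C\<ge>0. \<forall>\<theta>\<in>cube R. \<bar>divergence (J t) \<theta>\<bar> \<le> C * sqrt (\<rho> t \<theta>)" for R
  proof -
    have S: "open (T \<times> (UNIV :: 'a set))" and K: "compact ({t} \<times> cube R :: (real \<times> 'a) set)"
      and sub: "{t} \<times> cube R \<subseteq> T \<times> (UNIV :: 'a set)"
      using t_in by (auto intro: open_Times open_T compact_Times compact_cube)
    obtain C where "0 \<le> C" and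
      "\<And>z. z \<in> {t} \<times> cube R \<Longrightarrow> \<bar>frechet_derivative f (at z) (1, 0)\<bar> \<le> C * sqrt (f z)"
      using frechet_derivative_le_sqrt[OF f2 f_nonneg S K sub, of "(1, 0)"] by blast
    then have "\<bar>g (t, \<theta>)\<bar> \<le> C * sqrt (\<rho> t \<theta>)" if "\<theta> \<in> cube R" for \<theta>
      using that by (force simp: f_def g_def)
    with \<open>0 \<le> C\<close> show ?thesis unfolding g_eq[OF t_in] by blast
  qed
  have balance: "(LINT \<theta>|lborel. (ln (\<rho> t \<theta>) + 1) * divergence (J t) \<theta>) =
      (LINT \<theta>|lborel. \<rho> t \<theta> * laplacian U \<theta>)
      - \<beta> * (LINT \<theta>|lborel. \<rho> t \<theta> * (norm (gradient (\<lambda>x. ln (\<rho> t x)) \<theta>))\<^sup>2)"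
    unfolding J_def
  proof (rule entropy_balance[OF U_C2 \<rho>2[OF t_in] nonneg[OF t_in]])
    show "integrable lborel (\<lambda>\<theta>. (ln (\<rho> t \<theta>) + 1)
        * divergence (\<lambda>\<theta>. \<rho> t \<theta> *\<^sub>R gradient U \<theta> + \<beta> *\<^sub>R gradient (\<rho> t) \<theta>) \<theta>)"
      using leibniz(1) unfolding J_def .
    show "\<exists>C\<ge>0. \<forall>\<theta>\<in>cube R. \<bar>divergence (\<lambda>\<theta>. \<rho> t \<theta> *\<^sub>R gradient U \<theta> + \<beta> *\<^sub>R gradient (\<rho> t) \<theta>) \<theta>\<bar>
        \<le> C * sqrt (\<rho> t \<theta>)" for R
      using div_le[of R] unfolding J_def .
  qed (insert decay_t, (elim conjE, assumption)+)
  show ?thesis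
    using DERIV_minus[OF leibniz(2)] unfolding shannon_entropy_def balance by simp
qed

end
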